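(* Suppose $G=A*_{A\cap B} B$ is an amalgamated product and $H=\langle g_1,\dots, g_n\rangle \leq G$ is a finitely generated subgroup. Suppose $g_1$ is a generator of maximal length, i.e. $l(g_1)=\max_{j=1,\dots, n} \{l(g_j) \}$. Then: (i) $H$ is conjugate to a subgroup of one of the factors $A$, $B$ if and only if the generators $g_1,\dots, g_n$ and the products $g_{1} g_j$ for all $j\neq 1$ are bounded elements. (ii) Suppose that $H$ is conjugate into one of the factors and that $l(g_{1})>1$. Then $g_{1}$ has odd length. Let $g_{1}=k_1\cdots k_{2s+1}$ be a reduced expression of $g_{1}$, where $s \geq 1$. Then $(k_1\cdots k_s)^{-1} H (k_1\cdots k_s)$ is contained in one of the factors.
   Context: $G$ is a group with subgroups $A,B$ (the factors) such that $G$ is the free product of $A$ and $B$ amalgamated along $A\cap B$, written $G=A*_{A\cap B}B$. A reduced expression of $g\in G$ is an expression $g=g_1\cdots g_r$ with each $g_i\in A\cup B$, none of the $g_i$ in $A\cap B$, and $g_i$, $g_{i+1}$ in different factors for all $i$. All reduced expressions of a given $g\in G\setminus(A\cap B)$ have the same number of letters $r$, and the length is $l(g)=r$; if $g\in A\cap B$ then $l(g)=0$. A subgroup $H\le G$ is bounded if the set of lengths of its elements is bounded; an element $g\in G$ is bounded if the cyclic subgroup $\langle g\rangle$ is bounded. *)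

theory Defs
  imports "HOL-Algebra.Generated_Groups"
begin

definition list_prod :: "('a, 'm) monoid_scheme \<Rightarrow> 'a list \<Rightarrow> 'a" where
  "list_prod G xs = foldr (\<otimes>\<^bsub>G\<^esub>) xs \<one>\<^bsub>G\<^esub>"

text \<open>
  The free product of two subgroups \<open>A\<close>, \<open>B\<close> of \<open>G\<close> amalgamated along \<open>A \<inter> B\<close>: words
  over the disjoint union of \<open>A\<close> and \<open>B\<close>, modulo the congruence generated by the multiplication
  within each factor and the identification of the two copies of \<open>A \<inter> B\<close>. The group \<open>G\<close> enters
  only through the group structures of \<open>A\<close>, \<open>B\<close> and \<open>A \<inter> B\<close>.
\<close>

inductive amalgam_eq :: "('a, 'm) monoid_scheme \<Rightarrow> 'a set \<Rightarrow> 'a set \<Rightarrow>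
    ('a + 'a) list \<Rightarrow> ('a + 'a) list \<Rightarrow> bool"
  for G A B where
  refl: "w \<in> lists (A <+> B) \<Longrightarrow> amalgam_eq G A B w w"
| sym: "amalgam_eq G A B u v \<Longrightarrow> amalgam_eq G A B v u"
| trans: "amalgam_eq G A B u v \<Longrightarrow> amalgam_eq G A B v w \<Longrightarrow> amalgam_eq G A B u w"
| append: "amalgam_eq G A B u v \<Longrightarrow> amalgam_eq G A B u' v' \<Longrightarrow> amalgam_eq G A B (u @ u') (v @ v')"
| one_left: "amalgam_eq G A B [Inl \<one>\<^bsub>G\<^esub>] []"
| one_right: "amalgam_eq G A B [Inr \<one>\<^bsub>G\<^esub>] []"
| mult_left: "a \<in> A \<Longrightarrow> a' \<in> A \<Longrightarrow> amalgam_eq G A B [Inl a, Inl a'] [Inl (a \<otimes>\<^bsub>G\<^esub> a')]"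
| mult_right: "b \<in> B \<Longrightarrow> b' \<in> B \<Longrightarrow> amalgam_eq G A B [Inr b, Inr b'] [Inr (b \<otimes>\<^bsub>G\<^esub> b')]"
| amalg: "c \<in> A \<inter> B \<Longrightarrow> amalgam_eq G A B [Inl c] [Inr c]"

definition amalgam_rel ::
    "('a, 'm) monoid_scheme \<Rightarrow> 'a set \<Rightarrow> 'a set \<Rightarrow> (('a + 'a) list \<times> ('a + 'a) list) set" where
  "amalgam_rel G A B = {(u, v). amalgam_eq G A B u v}"

definition amalgam ::
    "('a, 'm) monoid_scheme \<Rightarrow> 'a set \<Rightarrow> 'a set \<Rightarrow> ('a + 'a) list set monoid" where
  "amalgam G A B =
    \<lparr>carrier = lists (A <+> B) // amalgam_rel G A B,
     monoid.mult = (\<lambda>X Y. \<Union>x\<in>X. \<Union>y\<in>Y. amalgam_rel G A B `` {x @ y}),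
     one = amalgam_rel G A B `` {[]}\<rparr>"

definition word_val :: "('a, 'm) monoid_scheme \<Rightarrow> ('a + 'a) list \<Rightarrow> 'a" where
  "word_val G w = list_prod G (map (case_sum id id) w)"

text \<open>
  The map \<open>A *\<^bsub>A \<inter> B\<^esub> B \<rightarrow> G\<close> induced by the two inclusions. All words in a class have
  the same value (\<open>word_val_eq\<close> below).
\<close>

definition amalgam_map :: "('a, 'm) monoid_scheme \<Rightarrow> ('a + 'a) list set \<Rightarrow> 'a" where
  "amalgam_map G X = the_elem (word_val G ` X)"

definition amalgamated_product :: "('a, 'm) monoid_scheme \<Rightarrow> 'a set \<Rightarrow> 'a set \<Rightarrow> bool" where
  "amalgamated_product G A B \<longleftrightarrow>
     group G \<and> subgroup A G \<and> subgroup B G \<and> amalgam_map G \<in> iso (amalgam G A B) G"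

definition reduced_expr ::
    "('a, 'm) monoid_scheme \<Rightarrow> 'a set \<Rightarrow> 'a set \<Rightarrow> 'a list \<Rightarrow> 'a \<Rightarrow> bool" where
  "reduced_expr G A B xs g \<longleftrightarrow>
     list_prod G xs = g \<and> set xs \<subseteq> A \<union> B \<and> set xs \<inter> (A \<inter> B) = {} \<and>
     (\<forall>i. Suc i < length xs \<longrightarrow>
        xs ! i \<in> A \<and> xs ! Suc i \<in> B \<or> xs ! i \<in> B \<and> xs ! Suc i \<in> A)"

definition len :: "('a, 'm) monoid_scheme \<Rightarrow> 'a set \<Rightarrow> 'a set \<Rightarrow> 'a \<Rightarrow> nat" where
  "len G A B g =
     (if g \<in> A \<inter> B then 0 else THE r. \<exists>xs. reduced_expr G A B xs g \<and> length xs = r)"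

definition bounded_subgroup ::
    "('a, 'm) monoid_scheme \<Rightarrow> 'a set \<Rightarrow> 'a set \<Rightarrow> 'a set \<Rightarrow> bool" where
  "bounded_subgroup G A B H \<longleftrightarrow> (\<exists>N. \<forall>h\<in>H. len G A B h \<le> N)"

definition bounded_element ::
    "('a, 'm) monoid_scheme \<Rightarrow> 'a set \<Rightarrow> 'a set \<Rightarrow> 'a \<Rightarrow> bool" where
  "bounded_element G A B g \<longleftrightarrow> bounded_subgroup G A B (generate G {g})"

definition conj_set :: "('a, 'm) monoid_scheme \<Rightarrow> 'a \<Rightarrow> 'a set \<Rightarrow> 'a set" where
  "conj_set G x H = (inv\<^bsub>G\<^esub> x <#\<^bsub>G\<^esub> H) #>\<^bsub>G\<^esub> x"

definition conj_to_subgroup_of ::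
    "('a, 'm) monoid_scheme \<Rightarrow> 'a set \<Rightarrow> 'a set \<Rightarrow> bool" where
  "conj_to_subgroup_of G H F \<longleftrightarrow>
     (\<exists>x\<in>carrier G. subgroup (conj_set G x H) G \<and> conj_set G x H \<subseteq> F)"


section \<open>The canonical map is well defined, and the universal property\<close>

lemma list_prod_Nil [simp]: "list_prod G [] = \<one>\<^bsub>G\<^esub>"
  and list_prod_Cons [simp]: "list_prod G (x # xs) = x \<otimes>\<^bsub>G\<^esub> list_prod G xs"
  by (simp_all add: list_prod_def)

lemma (in monoid) list_prod_closed: "set xs \<subseteq> carrier G \<Longrightarrow> list_prod G xs \<in> carrier G"
  by (induction xs) auto

lemma (in monoid) list_prod_append:
  "set xs \<subseteq> carrier G \<Longrightarrow> set ys \<subseteq> carrier G \<Longrightarrow>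
     list_prod G (xs @ ys) = list_prod G xs \<otimes> list_prod G ys"
  by (induction xs) (auto simp: m_assoc list_prod_closed)

lemma amalgam_eq_lists:
  assumes "subgroup A G" "subgroup B G" "amalgam_eq G A B u v"
  shows "u \<in> lists (A <+> B) \<and> v \<in> lists (A <+> B)"
  using assms(3)
  by induction
    (auto simp: subgroup.one_closed[OF assms(1)] subgroup.one_closed[OF assms(2)]
       subgroup.m_closed[OF assms(1)] subgroup.m_closed[OF assms(2)])

lemma equiv_amalgam_rel:
  assumes "subgroup A G" "subgroup B G"
  shows "equiv (lists (A <+> B)) (amalgam_rel G A B)"
  unfolding amalgam_rel_def
  using amalgam_eq_lists[OF assms]
  by (intro equivI refl_onI symI transI)
     (blast intro: amalgam_eq.refl amalgam_eq.sym amalgam_eq.trans)+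

lemma list_prod_hom_eq:
  assumes A: "subgroup A G" and B: "subgroup B G" and K: "group K"
    and f: "f \<in> hom (G\<lparr>carrier := A\<rparr>) K" and h: "h \<in> hom (G\<lparr>carrier := B\<rparr>) K"
    and fh: "\<And>c. c \<in> A \<inter> B \<Longrightarrow> f c = h c"
    and G: "group G" and eq: "amalgam_eq G A B u v"
  shows "list_prod K (map (case_sum f h) u) = list_prod K (map (case_sum f h) v)"
proof -
  interpret K: group K by fact
  interpret G: group G by fact
  have fc: "f a \<in> carrier K" if "a \<in> A" for a using f that by (auto simp: hom_def)
  have hc: "h a \<in> carrier K" if "a \<in> B" for a using h that by (auto simp: hom_def)
  have f1: "f \<one>\<^bsub>G\<^esub> = \<one>\<^bsub>K\<^esub>"
    using hom_one[OF f G.subgroup_imp_group[OF A] K] by simp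
  have h1: "h \<one>\<^bsub>G\<^esub> = \<one>\<^bsub>K\<^esub>"
    using hom_one[OF h G.subgroup_imp_group[OF B] K] by simp
  have cl: "set (map (case_sum f h) w) \<subseteq> carrier K" if "w \<in> lists (A <+> B)" for w
    using that by (auto simp: fc hc)
  from eq show ?thesis
  proof induction
    case (append u v u' v')
    then have "set (map (case_sum f h) u) \<subseteq> carrier K" "set (map (case_sum f h) u') \<subseteq> carrier K"
      "set (map (case_sum f h) v) \<subseteq> carrier K" "set (map (case_sum f h) v') \<subseteq> carrier K"
      using amalgam_eq_lists[OF A B] by (intro cl; blast)+
    then show ?case using append by (simp only: map_append K.list_prod_append)
  next
    case (mult_left a a') then show ?case
      using f subgroup.m_closed[OF A] by (auto simp: fc hom_def)
  next
    case (mult_right a a') then show ?case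
      using h subgroup.m_closed[OF B] by (auto simp: hc hom_def)
  qed (auto simp: f1 h1 fh)
qed

lemma subgroup_inclusion_hom:
  assumes "group G" "subgroup A G" shows "id \<in> hom (G\<lparr>carrier := A\<rparr>) G"
  using subgroup.subset[OF assms(2)] by (auto simp: hom_def)

lemma word_val_eq:
  assumes "group G" "subgroup A G" "subgroup B G" "amalgam_eq G A B u v"
  shows "word_val G u = word_val G v"
  unfolding word_val_def
  by (rule list_prod_hom_eq[of A G B]) (use assms in \<open>auto intro: subgroup_inclusion_hom\<close>)

lemma amalgam_map_class:
  assumes "group G" "subgroup A G" "subgroup B G" "w \<in> lists (A <+> B)"
  shows "amalgam_map G (amalgam_rel G A B `` {w}) = word_val G w"
proof -
  have "word_val G ` (amalgam_rel G A B `` {w}) = {word_val G w}"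
    using word_val_eq[OF assms(1-3)] amalgam_eq.refl[OF assms(4)]
    by (force simp: amalgam_rel_def)
  then show ?thesis by (simp add: amalgam_map_def)
qed

lemma amalgamated_product_words:
  assumes "amalgamated_product G A B"
  shows "\<And>g. g \<in> carrier G \<Longrightarrow> \<exists>w\<in>lists (A <+> B). word_val G w = g"
    and "\<And>u v. u \<in> lists (A <+> B) \<Longrightarrow> v \<in> lists (A <+> B) \<Longrightarrow> word_val G u = word_val G v \<Longrightarrow>
           amalgam_eq G A B u v"
proof -
  have G: "group G" and A: "subgroup A G" and B: "subgroup B G"
    and iso: "amalgam_map G \<in> iso (amalgam G A B) G"
    using assms by (simp_all only: amalgamated_product_def)
  have carr: "carrier (amalgam G A B) = lists (A <+> B) // amalgam_rel G A B"
    by (simp only: amalgam_def partial_object.simps)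
  have bij: "bij_betw (amalgam_map G) (lists (A <+> B) // amalgam_rel G A B) (carrier G)"
    using iso by (simp only: iso_def mem_Collect_eq carr)
  note cls = amalgam_map_class[OF G A B]
  show "\<exists>w\<in>lists (A <+> B). word_val G w = g" if "g \<in> carrier G" for g
  proof -
    have "g \<in> amalgam_map G ` (lists (A <+> B) // amalgam_rel G A B)"
      using that by (simp only: bij_betw_imp_surj_on[OF bij])
    then obtain X where X: "g = amalgam_map G X" "X \<in> lists (A <+> B) // amalgam_rel G A B"
      by (rule imageE)
    from X(2) obtain w where w: "w \<in> lists (A <+> B)" "X = amalgam_rel G A B `` {w}"
      by (rule quotientE)
    have "word_val G w = g" using cls[OF w(1)] w(2) X(1) by simp
    then show ?thesis using w(1) by (rule bexI)
  qed
  show "amalgam_eq G A B u v"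
    if u: "u \<in> lists (A <+> B)" and v: "v \<in> lists (A <+> B)" and "word_val G u = word_val G v" for u v
  proof -
    have "amalgam_rel G A B `` {u} = amalgam_rel G A B `` {v}"
      by (rule inj_onD[OF bij_betw_imp_inj_on[OF bij]])
         (simp_all only: cls[OF u] cls[OF v] that(3) quotientI[OF u] quotientI[OF v])
    then show ?thesis
      using eq_equiv_class[OF _ equiv_amalgam_rel[OF A B] v] by (simp add: amalgam_rel_def)
  qed
qed

theorem amalgamated_product_universal:
  fixes G :: "('a, 'm) monoid_scheme" and K :: "('k, 'n) monoid_scheme"
  assumes am: "amalgamated_product G A B" and K: "group K"
    and f: "f \<in> hom (G\<lparr>carrier := A\<rparr>) K" and h: "h \<in> hom (G\<lparr>carrier := B\<rparr>) K"
    and fh: "\<And>c. c \<in> A \<inter> B \<Longrightarrow> f c = h c"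
  shows "\<exists>F\<in>hom G K. (\<forall>a\<in>A. F a = f a) \<and> (\<forall>b\<in>B. F b = h b) \<and>
           (\<forall>F'\<in>hom G K. (\<forall>a\<in>A. F' a = f a) \<and> (\<forall>b\<in>B. F' b = h b) \<longrightarrow>
              (\<forall>g\<in>carrier G. F' g = F g))"
proof -
  have G: "group G" and A: "subgroup A G" and B: "subgroup B G"
    using am by (auto simp: amalgamated_product_def)
  interpret K: group K by fact
  interpret G: group G by fact
  note words = amalgamated_product_words[OF am]
  define k where "k w = list_prod K (map (case_sum f h) w)" for w
  have fc: "f a \<in> carrier K" if "a \<in> A" for a using f that by (auto simp: hom_def)
  have hc: "h a \<in> carrier K" if "a \<in> B" for a using h that by (auto simp: hom_def)
  have cl: "set (map (case_sum f h) w) \<subseteq> carrier K" if "w \<in> lists (A <+> B)" for w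
    using that by (auto simp: fc hc)
  have clG: "set (map (case_sum id id) w) \<subseteq> carrier G" if "w \<in> lists (A <+> B)" for w
    using that subgroup.mem_carrier[OF A] subgroup.mem_carrier[OF B] by auto
  define wd where "wd g = (SOME w. w \<in> lists (A <+> B) \<and> word_val G w = g)" for g
  have wd: "wd g \<in> lists (A <+> B) \<and> word_val G (wd g) = g" if "g \<in> carrier G" for g
    unfolding wd_def by (rule someI_ex) (use words(1)[OF that] in blast)
  have kF: "k (wd (word_val G w)) = k w" if w: "w \<in> lists (A <+> B)" for w
  proof -
    have "word_val G w \<in> carrier G"
      unfolding word_val_def using clG[OF w] by (rule G.list_prod_closed)
    then have "amalgam_eq G A B (wd (word_val G w)) w"
      using wd w by (intro words(2)) auto
    then show ?thesis unfolding k_def by - (rule list_prod_hom_eq[OF A B K f h fh G])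
  qed
  have kv: "word_val G (u @ v) = word_val G u \<otimes>\<^bsub>G\<^esub> word_val G v" "k (u @ v) = k u \<otimes>\<^bsub>K\<^esub> k v"
    if "u \<in> lists (A <+> B)" "v \<in> lists (A <+> B)" for u v
    unfolding word_val_def k_def map_append
    by (rule G.list_prod_append[OF clG clG] K.list_prod_append[OF cl cl]; fact)+
  have "(\<lambda>g. k (wd g)) \<in> hom G K"
  proof (rule homI)
    fix x assume "x \<in> carrier G"
    then show "k (wd x) \<in> carrier K" unfolding k_def using cl wd by (blast intro: K.list_prod_closed)
  next
    fix x y assume x: "x \<in> carrier G" and y: "y \<in> carrier G"
    have "k (wd (x \<otimes>\<^bsub>G\<^esub> y)) = k (wd x @ wd y)"
      using kF[of "wd x @ wd y"] kv(1)[of "wd x" "wd y"] wd[OF x] wd[OF y] by simp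
    then show "k (wd (x \<otimes>\<^bsub>G\<^esub> y)) = k (wd x) \<otimes>\<^bsub>K\<^esub> k (wd y)"
      using kv(2)[of "wd x" "wd y"] wd[OF x] wd[OF y] by simp
  qed
  moreover have "k (wd a) = f a" if "a \<in> A" for a
    using kF[of "[Inl a]"] that fc[OF that] subgroup.mem_carrier[OF A that]
    by (auto simp: word_val_def k_def)
  moreover have "k (wd b) = h b" if "b \<in> B" for b
    using kF[of "[Inr b]"] that hc[OF that] subgroup.mem_carrier[OF B that]
    by (auto simp: word_val_def k_def)
  moreover have "F' g = k (wd g)"
    if F': "F' \<in> hom G K" "\<forall>a\<in>A. F' a = f a" "\<forall>b\<in>B. F' b = h b" and g: "g \<in> carrier G" for F' g
  proof -
    have "F' (word_val G w) = k w" if "w \<in> lists (A <+> B)" for w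
      using that
    proof (induction w rule: list.induct)
      case Nil
      then show ?case using hom_one[OF F'(1) G K] by (simp add: word_val_def k_def)
    next
      case (Cons x w)
      then have w1: "w \<in> lists (A <+> B)" by simp
      have w2: "word_val G w \<in> carrier G"
        unfolding word_val_def using clG[OF w1] by (rule G.list_prod_closed)
      note w = w1 w2
      have x: "case_sum id id x \<in> carrier G" "F' (case_sum id id x) = case_sum f h x"
        using Cons.prems F' subgroup.subset[OF A] subgroup.subset[OF B] by auto
      show ?case
        using Cons.IH[OF w(1)] w x hom_mult[OF F'(1) x(1) w(2)]
        by (simp add: word_val_def k_def)
    qed
    then show ?thesis using wd[OF g] by metis
  qed
  ultimately show ?thesis by (intro bexI[of _ "\<lambda>g. k (wd g)"]) auto
qed

end

theory Submission
  imports Defs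
begin

text \<open>
  In terms of the Bass--Serre tree, whose vertices are the cosets of \<open>A\<close> and \<open>B\<close> and whose edges are
  the cosets of \<open>A \<inter> B\<close>, a bounded element is one that fixes a vertex. Half of the length of such an
  element is essentially the distance of its fixed point set from the base edge. The vertex fixed by
  \<open>g 1\<close> that is nearest to the base edge is at least as far away as the vertices nearest to it that
  the other generators fix; because \<open>g 1\<close> and \<open>g j\<close> have a common fixed point when their product is
  bounded too, \<open>g j\<close> must fix this very vertex. So a single vertex, which depends on \<open>g 1\<close> only, is
  fixed by all generators, and its stabiliser is a conjugate of a factor.

  The proof below says this with words. Lengths are meaningful because two reduced words with the
  same value have equally many letters (\<open>reduced_length_unique\<close>). Here it enters that \<open>G\<close>
  has no relations but those of the amalgam: a group given in this way acts on normal forms, in the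
  manner of van der Waerden, and the normal form of an element determines the number of letters. A
  reduced word of even length begins and ends in different factors, so its powers are reduced as
  they stand and its value is unbounded (\<open>bounded_reduced_odd\<close>). Hence a bounded
  element of positive length has odd length \<open>2 * s + 1\<close>. Conjugating it by its first letter gives a
  shorter word of even length, unless the first and the last letter cancel into \<open>A \<inter> B\<close>; iterating,
  the prefix \<open>u\<close> of length \<open>s\<close> conjugates it to a letter \<open>a\<close> of a factor \<open>F\<close>
  (\<open>bounded_conj_by_half\<close>).

  Now take \<open>g 1\<close> as this element and let \<open>h\<close> be the conjugate of another generator by \<open>u\<close>. If \<open>h\<close> is not
  in \<open>F\<close>, it has a reduced word of odd length. When this word begins and ends outside \<open>F\<close>, putting \<open>a\<close>
  in front of it gives a reduced word of even length, so the product of the two generators is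
  unbounded. When it begins and ends in \<open>F\<close>, it has at least three letters, and nothing cancels in
  \<open>u h u\<inverse>\<close>, so that this generator is longer than \<open>g 1\<close>. Both are excluded
  (\<open>bounded_conj_by_in_factor\<close>), and \<open>u\<close> conjugates all of \<open>H\<close> into \<open>F\<close>. This gives both
  the hard direction of the equivalence and the explicit conjugating element. Conversely,
  boundedness is invariant under conjugation, and elements of a factor have length at most one.
\<close>

section \<open>Reduced words\<close>

locale amalgamated_group = group G for G (structure) and A B +
  assumes amalgamated: "amalgamated_product G A B"
begin

sublocale A: subgroup A G using amalgamated by (simp add: amalgamated_product_def)
sublocale B: subgroup B G using amalgamated by (simp add: amalgamated_product_def)

abbreviation letters :: "'a set" where
  "letters \<equiv> A \<union> B - A \<inter> B"

text \<open>
  A letter is in exactly one factor, so that membership in \<open>A\<close> alone decides whether two letters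
  are in different factors.
\<close>

definition reduced :: "'a list \<Rightarrow> bool" where
  "reduced xs \<longleftrightarrow> set xs \<subseteq> letters \<and> successively (\<lambda>x y. (x \<in> A) \<noteq> (y \<in> A)) xs"

lemma reduced_Nil [simp]: "reduced []"
  by (simp add: reduced_def)

lemma reduced_Cons:
  "reduced (x # xs) \<longleftrightarrow>
     x \<in> letters \<and> reduced xs \<and> (xs \<noteq> [] \<longrightarrow> (x \<in> A) \<noteq> (hd xs \<in> A))"
  unfolding reduced_def by (cases xs) auto

lemma reduced_append:
  "reduced (xs @ ys) \<longleftrightarrow>
     reduced xs \<and> reduced ys \<and> (xs \<noteq> [] \<and> ys \<noteq> [] \<longrightarrow> (last xs \<in> A) \<noteq> (hd ys \<in> A))"
  unfolding reduced_def by (auto simp: successively_append_iff)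

lemma reduced_letters: "reduced xs \<Longrightarrow> set xs \<subseteq> letters"
  by (simp add: reduced_def)

lemma letters_carrier: "letters \<subseteq> carrier G"
  using A.subset B.subset by auto

lemma reduced_carrier: "reduced xs \<Longrightarrow> set xs \<subseteq> carrier G"
  using reduced_letters letters_carrier by blast

lemma reduced_closed: "reduced xs \<Longrightarrow> list_prod G xs \<in> carrier G"
  by (simp add: reduced_carrier list_prod_closed)

lemma reduced_expr_iff: "reduced_expr G A B xs g \<longleftrightarrow> list_prod G xs = g \<and> reduced xs"
proof -
  have "(x \<in> A \<and> y \<in> B \<or> x \<in> B \<and> y \<in> A) \<longleftrightarrow> (x \<in> A) \<noteq> (y \<in> A)"
    if "x \<in> letters" "y \<in> letters" for x y
    using that by auto
  then have "(\<forall>i. Suc i < length xs \<longrightarrow>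
        xs ! i \<in> A \<and> xs ! Suc i \<in> B \<or> xs ! i \<in> B \<and> xs ! Suc i \<in> A) \<longleftrightarrow>
      (\<forall>i. Suc i < length xs \<longrightarrow> (xs ! i \<in> A) \<noteq> (xs ! Suc i \<in> A))"
    if "set xs \<subseteq> letters"
    using that by (meson nth_mem Suc_lessD subsetD)
  then show ?thesis
    unfolding reduced_expr_def reduced_def successively_conv_nth by blast
qed

text \<open>
  The factors of the letters alternate, so the parity of the length decides whether the two ends
  are in the same factor.
\<close>

lemma hd_last_reduced:
  "reduced xs \<Longrightarrow> xs \<noteq> [] \<Longrightarrow> (hd xs \<in> A) = (last xs \<in> A) \<longleftrightarrow> odd (length xs)"
proof (induction xs)
  case (Cons x xs)
  then show ?case by (cases "xs = []") (auto simp: reduced_Cons)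
qed simp

text \<open>
  From here on, \<open>F\<close> stands for either of the two factors, so that the symmetry between \<open>A\<close> and \<open>B\<close> can
  be used although \<open>reduced\<close> refers to \<open>A\<close>. The amalgamated subgroup \<open>A \<inter> B\<close> is called the core: its
  elements can be absorbed into a neighbouring letter without changing the factor of that letter.
\<close>

lemma factor_subgroup: "F = A \<or> F = B \<Longrightarrow> subgroup F G"
  using A.subgroup_axioms B.subgroup_axioms by auto

lemma letter_in_factor:
  assumes "F = A \<or> F = B" "x \<in> letters" "y \<in> letters"
  shows "(x \<in> F) = (y \<in> F) \<longleftrightarrow> (x \<in> A) = (y \<in> A)"
  using assms by auto

lemma core_subgroup: "subgroup (A \<inter> B) G"
  using subgroups_Inter_pair[OF A.subgroup_axioms B.subgroup_axioms] .

lemma subgroup_mult_iff: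
  assumes "subgroup K G" "x \<in> carrier G" "k \<in> K"
  shows "k \<otimes> x \<in> K \<longleftrightarrow> x \<in> K" "x \<otimes> k \<in> K \<longleftrightarrow> x \<in> K"
proof -
  interpret K: subgroup K G by fact
  have "inv k \<otimes> (k \<otimes> x) = x" "(x \<otimes> k) \<otimes> inv k = x"
    using assms K.subset by (auto simp: m_assoc[symmetric]) (simp add: m_assoc subset_eq)
  then show "k \<otimes> x \<in> K \<longleftrightarrow> x \<in> K" "x \<otimes> k \<in> K \<longleftrightarrow> x \<in> K"
    using assms by (metis K.m_closed K.m_inv_closed)+
qed

lemma core_mult_iff:
  assumes "F = A \<or> F = B" "c \<in> A \<inter> B" "x \<in> carrier G"
  shows "c \<otimes> x \<in> F \<longleftrightarrow> x \<in> F" "x \<otimes> c \<in> F \<longleftrightarrow> x \<in> F"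
  using subgroup_mult_iff[of F x c] factor_subgroup[of F] assms by auto

lemma core_mult_letter:
  assumes "c \<in> A \<inter> B" "x \<in> letters"
  shows "c \<otimes> x \<in> letters" "x \<otimes> c \<in> letters"
  using core_mult_iff[of A c x] core_mult_iff[of B c x] assms letters_carrier by auto

lemma reduced_core_Cons:
  assumes "c \<in> A \<inter> B" "reduced (x # xs)"
  shows "reduced ((c \<otimes> x) # xs)"
  using assms core_mult_letter[of c x] core_mult_iff[of A c x] letters_carrier
  by (auto simp: reduced_Cons)

lemma reduced_snoc_core:
  assumes "c \<in> A \<inter> B" "reduced (xs @ [x])"
  shows "reduced (xs @ [x \<otimes> c])"
  using assms core_mult_letter[of c x] core_mult_iff[of A c x] letters_carrier
  by (auto simp: reduced_append reduced_Cons)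

section \<open>The action on normal forms\<close>

text \<open>
  A normal form \<open>(c, ts)\<close> stands for the element \<open>c \<otimes> list_prod G ts\<close>, where \<open>c\<close> is in the core and
  \<open>ts\<close> is a reduced word of chosen representatives of right cosets of the core. The factor \<open>F\<close> acts on
  normal forms through a bijection with the pairs of an element of \<open>F\<close> and a tail that does not begin
  in \<open>F\<close>: \<open>pull F\<close> merges a first letter from \<open>F\<close> into \<open>c\<close>, \<open>push\<close> splits it off again, and between
  the two, elements of \<open>F\<close> act by left multiplication on the first component. This form makes it
  immediate that \<open>act F\<close> is an action. The actions of \<open>A\<close> and \<open>B\<close> agree on the core, so they extend to
  words over the two factors, and equivalent words act in the same way.
\<close>

definition rep :: "'a \<Rightarrow> 'a" where
  "rep y = (SOME t. t \<in> (A \<inter> B) #> y)"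

lemma rep:
  assumes "y \<in> carrier G"
  obtains c where "c \<in> A \<inter> B" "rep y = c \<otimes> y"
proof -
  have "y \<in> (A \<inter> B) #> y"
    using rcos_self[OF assms core_subgroup] .
  then have "rep y \<in> (A \<inter> B) #> y" unfolding rep_def by (rule someI)
  then show ?thesis using that by (auto simp: r_coset_def)
qed

lemma rep_core_mult:
  assumes "c \<in> A \<inter> B" "y \<in> carrier G"
  shows "rep (c \<otimes> y) = rep y"
proof -
  have "(A \<inter> B) #> (c \<otimes> y) = (A \<inter> B) #> y"
    using coset_mult_assoc[of "A \<inter> B" c y] coset_join2[of c "A \<inter> B"] core_subgroup assms
      A.subset by auto
  then show ?thesis by (simp add: rep_def)
qed

definition normal_form :: "'a \<times> 'a list \<Rightarrow> bool" where
  "normal_form z \<longleftrightarrow> fst z \<in> A \<inter> B \<and> reduced (snd z) \<and> (\<forall>t\<in>set (snd z). rep t = t)"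

fun pull :: "'a set \<Rightarrow> 'a \<times> 'a list \<Rightarrow> 'a \<times> 'a list" where
  "pull F (c, []) = (c, [])"
| "pull F (c, t # ts) = (if t \<in> F then (c \<otimes> t, ts) else (c, t # ts))"

definition push :: "'a \<times> 'a list \<Rightarrow> 'a \<times> 'a list" where
  "push = (\<lambda>(y, ts). if y \<in> A \<inter> B then (y, ts) else (y \<otimes> inv (rep y), rep y # ts))"

definition act :: "'a set \<Rightarrow> 'a \<Rightarrow> 'a \<times> 'a list \<Rightarrow> 'a \<times> 'a list" where
  "act F x z = push (apfst ((\<otimes>) x) (pull F z))"

definition tails :: "'a set \<Rightarrow> 'a list set" where
  "tails F = {ts. reduced ts \<and> (\<forall>t\<in>set ts. rep t = t) \<and> (ts \<noteq> [] \<longrightarrow> hd ts \<notin> F)}"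

lemma pull_normal:
  assumes F: "F = A \<or> F = B" and z: "normal_form z"
  shows "pull F z \<in> F \<times> tails F" "push (pull F z) = z"
proof -
  obtain c ts where zc: "z = (c, ts)" by (cases z)
  interpret F: subgroup F G using factor_subgroup[OF F] .
  have c: "c \<in> A \<inter> B" "c \<in> F" "c \<in> carrier G" using z zc F A.subset by (auto simp: normal_form_def)
  have "pull F z \<in> F \<times> tails F \<and> push (pull F z) = z"
  proof (cases "ts \<noteq> [] \<and> hd ts \<in> F")
    case True
    then obtain t r where ts: "ts = t # r" "t \<in> F" by (cases ts) auto
    have t: "t \<in> letters" "rep t = t" "t \<in> carrier G" "reduced r"
      "r \<noteq> [] \<Longrightarrow> (t \<in> A) \<noteq> (hd r \<in> A)" "\<forall>t\<in>set r. rep t = t"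
      using z zc ts letters_carrier by (auto simp: normal_form_def reduced_Cons)
    have "hd r \<notin> F" if "r \<noteq> []"
      using letter_in_factor[OF F t(1), of "hd r"] t(5)[OF that] reduced_letters[OF t(4)] that ts(2)
      by (metis hd_in_set subsetD)
    moreover have "c \<otimes> t \<notin> A \<inter> B" using core_mult_letter[OF c(1) t(1)] by blast
    moreover have "c \<otimes> t \<otimes> inv t = c" using c t by (simp add: m_assoc)
    ultimately show ?thesis
      using zc ts c t rep_core_mult[OF c(1) t(3)] by (auto simp: push_def tails_def)
  next
    case False
    then have "pull F z = z" using zc by (cases ts) auto
    then show ?thesis using False z zc c by (auto simp: push_def tails_def normal_form_def)
  qed
  then show "pull F z \<in> F \<times> tails F" "push (pull F z) = z" by auto
qed

lemma push_tails:
  assumes F: "F = A \<or> F = B" and y: "y \<in> F" and ts: "ts \<in> tails F"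
  shows "normal_form (push (y, ts))" "pull F (push (y, ts)) = (y, ts)"
proof -
  interpret F: subgroup F G using factor_subgroup[OF F] .
  have yc: "y \<in> carrier G" using y by simp
  have "normal_form (push (y, ts)) \<and> pull F (push (y, ts)) = (y, ts)"
  proof (cases "y \<in> A \<inter> B")
    case True
    then show ?thesis using ts by (cases ts) (auto simp: push_def normal_form_def tails_def)
  next
    case False
    then have yl: "y \<in> letters" using y F by auto
    obtain c where c: "c \<in> A \<inter> B" "rep y = c \<otimes> y" using rep[OF yc] .
    have cc: "c \<in> carrier G" using c A.subset by auto
    have r: "rep y \<in> letters" "rep y \<in> F" "rep (rep y) = rep y" "rep y \<in> carrier G"
      using core_mult_letter[OF c(1) yl] core_mult_iff[OF F c(1) yc] c y yc
        rep_core_mult[OF c(1) yc] cc by auto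
    have "y \<otimes> inv (rep y) = inv c"
      using cc yc by (simp add: c(2) inv_mult_group m_assoc[symmetric])
    moreover have "inv c \<in> A \<inter> B" using c(1) by auto
    ultimately have ic: "y \<otimes> inv (rep y) \<in> A \<inter> B" by simp
    have "reduced (rep y # ts)"
      using ts r letter_in_factor[OF F r(1), of "hd ts"] reduced_letters[of ts]
      by (cases ts) (auto simp: reduced_Cons tails_def)
    then show ?thesis
      using False ts r ic yc by (auto simp: push_def normal_form_def tails_def m_assoc)
  qed
  then show "normal_form (push (y, ts))" "pull F (push (y, ts)) = (y, ts)" by auto
qed

lemma act_normal:
  assumes F: "F = A \<or> F = B" and x: "x \<in> F" and z: "normal_form z"
  shows "normal_form (act F x z)" "pull F (act F x z) = apfst ((\<otimes>) x) (pull F z)"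
proof -
  interpret F: subgroup F G using factor_subgroup[OF F] .
  obtain y ts where p: "pull F z = (y, ts)" by (cases "pull F z")
  then have "y \<in> F" "ts \<in> tails F" using pull_normal[OF F z] by auto
  then show "normal_form (act F x z)" "pull F (act F x z) = apfst ((\<otimes>) x) (pull F z)"
    using push_tails[OF F, of "x \<otimes> y" ts] x by (auto simp: act_def p)
qed

lemma act_mult:
  assumes F: "F = A \<or> F = B" and "x \<in> F" "y \<in> F" "normal_form z"
  shows "act F x (act F y z) = act F (x \<otimes> y) z"
proof -
  interpret F: subgroup F G using factor_subgroup[OF F] .
  have "apfst ((\<otimes>) x) (apfst ((\<otimes>) y) (pull F z)) = apfst ((\<otimes>) (x \<otimes> y)) (pull F z)"
    using assms pull_normal(1)[OF F assms(4)] by (auto simp: m_assoc)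
  then show ?thesis using act_normal(2)[OF F assms(3,4)] by (simp add: act_def)
qed

lemma act_one:
  assumes F: "F = A \<or> F = B" and "normal_form z"
  shows "act F \<one> z = z"
proof -
  interpret F: subgroup F G using factor_subgroup[OF F] .
  have "apfst ((\<otimes>) \<one>) (pull F z) = pull F z"
    using pull_normal(1)[OF assms] by auto
  then show ?thesis using pull_normal(2)[OF assms] by (simp add: act_def)
qed

lemma act_core:
  assumes F: "F = A \<or> F = B" and c: "c \<in> A \<inter> B" and z: "normal_form (d, ts)"
  shows "act F c (d, ts) = (c \<otimes> d, ts)"
proof -
  have d: "d \<in> A \<inter> B" "c \<otimes> d \<in> A \<inter> B" "c \<in> carrier G" "d \<in> carrier G" "set ts \<subseteq> carrier G"
    using z c A.subset reduced_carrier by (auto simp: normal_form_def)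
  have "normal_form (c \<otimes> d, ts)" using z d by (simp add: normal_form_def)
  moreover have "apfst ((\<otimes>) c) (pull F (d, ts)) = pull F (c \<otimes> d, ts)"
    using d by (cases ts) (auto simp: m_assoc)
  ultimately show ?thesis using pull_normal(2)[OF F] by (simp add: act_def)
qed

definition act_word :: "('a + 'a) list \<Rightarrow> 'a \<times> 'a list \<Rightarrow> 'a \<times> 'a list" where
  "act_word w = foldr (case_sum (act A) (act B)) w"

lemma act_word_simps [simp]:
  "act_word [] z = z" "act_word (Inl a # w) z = act A a (act_word w z)"
  "act_word (Inr b # w) z = act B b (act_word w z)"
  "act_word (v @ w) z = act_word v (act_word w z)"
  by (simp_all add: act_word_def)

lemma act_word_normal: "w \<in> lists (A <+> B) \<Longrightarrow> normal_form z \<Longrightarrow> normal_form (act_word w z)"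
proof (induction w)
  case (Cons x w)
  then have "normal_form (act_word w z)" by simp
  then show ?case using Cons.prems(1) act_normal(1)[of A _ "act_word w z"]
    act_normal(1)[of B _ "act_word w z"] by auto
qed simp

lemma act_word_eq:
  "amalgam_eq G A B u v \<Longrightarrow> normal_form z \<Longrightarrow> act_word u z = act_word v z"
proof (induction arbitrary: z rule: amalgam_eq.induct)
  case (append u v u' v')
  have "v' \<in> lists (A <+> B)"
    using amalgam_eq_lists[OF A.subgroup_axioms B.subgroup_axioms append.hyps(2)] by simp
  then show ?case using append act_word_normal by simp
next
  case (amalg c)
  then show ?case using act_core by (cases z) auto
qed (auto simp: act_one act_mult)

text \<open>
  Letters of the core lie in both factors; sending them to the left copy is an arbitrary choice.
\<close>

definition tagged :: "'a list \<Rightarrow> ('a + 'a) list" where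
  "tagged = map (\<lambda>x. if x \<in> A then Inl x else Inr x)"

lemma word_val_tagged: "word_val G (tagged xs) = list_prod G xs"
  unfolding word_val_def tagged_def by (induction xs) auto

lemma tagged_lists: "set xs \<subseteq> A \<union> B \<Longrightarrow> tagged xs \<in> lists (A <+> B)"
  unfolding tagged_def by auto

lemma normal_one: "normal_form (\<one>, [])"
  by (simp add: normal_form_def)

lemma act_word_cong:
  assumes "set xs \<subseteq> A \<union> B" "set ys \<subseteq> A \<union> B" "list_prod G xs = list_prod G ys"
  shows "act_word (tagged xs) (\<one>, []) = act_word (tagged ys) (\<one>, [])"
  using assms amalgamated_product_words(2)[OF amalgamated] tagged_lists word_val_tagged
  by (intro act_word_eq normal_one) auto

text \<open>
  A letter from the factor in which the normal form does not begin makes the normal form longer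
  by one. This is why a reduced word, applied to the normal form of the neutral element, produces a
  normal form of the same length.
\<close>

lemma act_letter:
  assumes F: "F = A \<or> F = B" and z: "normal_form (c, ts)" and x: "x \<in> F" "x \<in> letters"
    and ts: "ts \<noteq> [] \<Longrightarrow> hd ts \<notin> F"
  obtains d t where "act F x (c, ts) = (d, t # ts)" "t \<in> F" "t \<in> letters"
proof -
  have c: "c \<in> A \<inter> B" using z by (simp add: normal_form_def)
  have "pull F (c, ts) = (c, ts)" using ts by (cases ts) auto
  moreover have xl: "x \<otimes> c \<in> letters" using core_mult_letter[OF c x(2)] by simp
  moreover have xF: "x \<otimes> c \<in> F" using core_mult_iff[OF F c] x letters_carrier by blast
  ultimately have e: "act F x (c, ts) = (x \<otimes> c \<otimes> inv (rep (x \<otimes> c)), rep (x \<otimes> c) # ts)"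
    by (auto simp: act_def push_def)
  obtain d where d: "d \<in> A \<inter> B" "rep (x \<otimes> c) = d \<otimes> (x \<otimes> c)"
    using rep[of "x \<otimes> c"] xl letters_carrier by blast
  have "rep (x \<otimes> c) \<in> F" "rep (x \<otimes> c) \<in> letters"
    using core_mult_iff[OF F d(1)] core_mult_letter[OF d(1) xl] xF xl letters_carrier d by auto
  then show ?thesis using e that by blast
qed

lemma act_word_reduced:
  assumes "reduced xs"
  shows "length (snd (act_word (tagged xs) (\<one>, []))) = length xs \<and>
    (xs \<noteq> [] \<longrightarrow> (hd (snd (act_word (tagged xs) (\<one>, []))) \<in> A) = (hd xs \<in> A))"
  using assms
proof (induction xs)
  case Nil
  then show ?case by (simp add: tagged_def)
next
  case (Cons x xs)
  obtain c ts where z: "act_word (tagged xs) (\<one>, []) = (c, ts)" by fastforce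
  have x: "x \<in> letters" "reduced xs" "xs \<noteq> [] \<Longrightarrow> (x \<in> A) \<noteq> (hd xs \<in> A)"
    using Cons.prems by (auto simp: reduced_Cons)
  have n: "normal_form (c, ts)"
    using act_word_normal[OF tagged_lists normal_one] reduced_letters[OF x(2)] z
    by (metis Diff_subset subset_trans)
  have ih: "length ts = length xs" "xs \<noteq> [] \<Longrightarrow> (hd ts \<in> A) = (hd xs \<in> A)"
    using Cons.IH[OF x(2)] z by auto
  define F where "F = (if x \<in> A then A else B)"
  have F: "F = A \<or> F = B" "x \<in> F" using x(1) by (auto simp: F_def)
  have "hd ts \<notin> F" if "ts \<noteq> []"
  proof -
    have "hd ts \<in> letters"
      using n that reduced_letters[of ts] hd_in_set by (auto simp: normal_form_def)
    moreover have "(x \<in> A) \<noteq> (hd ts \<in> A)" using that ih x(3) by (cases "xs = []") auto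
    ultimately show ?thesis using letter_in_factor[OF F(1) x(1)] F(2) by blast
  qed
  then obtain d t where t: "act F x (c, ts) = (d, t # ts)" "t \<in> F" "t \<in> letters"
    using act_letter[OF F(1) n F(2) x(1)] by blast
  have "act_word (tagged (x # xs)) (\<one>, []) = (d, t # ts)"
    using t(1) z by (auto simp: tagged_def F_def)
  moreover have "(t \<in> A) = (x \<in> A)" using letter_in_factor[OF F(1) t(3) x(1)] F t by auto
  ultimately show ?case using ih by simp
qed

text \<open>
  The normal form of an element depends on the element only, and it has as many representatives as
  any reduced word for the element has letters. An element \<open>c\<close> of the core has the normal form
  \<open>(c, [])\<close>.
\<close>

lemma reduced_length_unique:
  assumes "reduced xs" "reduced ys" "list_prod G xs = list_prod G ys"
  shows "length xs = length ys"
proof -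
  have "act_word (tagged xs) (\<one>, []) = act_word (tagged ys) (\<one>, [])"
    using reduced_letters assms by (intro act_word_cong) auto
  then show ?thesis using act_word_reduced assms(1,2) by metis
qed

lemma reduced_prod_core:
  assumes "reduced xs" "list_prod G xs \<in> A \<inter> B"
  shows "xs = []"
proof -
  define c where "c = list_prod G xs"
  have c: "c \<in> A \<inter> B" "c \<in> carrier G" using assms A.subset by (auto simp: c_def)
  have "act_word (tagged [c]) (\<one>, []) = (c, [])"
    using act_core[OF _ c(1) normal_one] c by (auto simp: tagged_def)
  moreover have "act_word (tagged xs) (\<one>, []) = act_word (tagged [c]) (\<one>, [])"
    using c reduced_letters[OF assms(1)] by (intro act_word_cong) (auto simp: c_def)
  ultimately show ?thesis using act_word_reduced[OF assms(1)] by simp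
qed

section \<open>Length\<close>

lemma len_core: "g \<in> A \<inter> B \<Longrightarrow> len G A B g = 0"
  by (simp add: len_def)

lemma len_reduced:
  assumes "reduced xs"
  shows "len G A B (list_prod G xs) = length xs"
proof (cases "list_prod G xs \<in> A \<inter> B")
  case True
  then show ?thesis using reduced_prod_core[OF assms True] len_core[OF True] by simp
next
  case False
  have "(THE r. \<exists>ys. reduced_expr G A B ys (list_prod G xs) \<and> length ys = r) = length xs"
    unfolding reduced_expr_iff using reduced_length_unique assms by (intro the_equality) blast+
  then show ?thesis by (simp only: len_def False if_False)
qed

text \<open>
  Letters are multiplied to the front one at a time. The product of a letter with the first letter of a
  reduced word from the same factor can fall into the core; it is then absorbed by the second letter.
  If there is no second letter, or if the word was in the core before, the result may be in the core,
  where only the neutral element has a reduced word; hence the first alternative.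
\<close>

lemma word_reduction:
  "set xs \<subseteq> A \<union> B \<Longrightarrow>
     list_prod G xs \<in> A \<inter> B \<or>
     (\<exists>ys. reduced ys \<and> list_prod G ys = list_prod G xs \<and> length ys \<le> length xs)"
proof (induction xs)
  case Nil
  then show ?case by simp
next
  case (Cons x xs)
  define p where "p = list_prod G xs"
  have pc: "p \<in> carrier G"
    using Cons.prems A.subset B.subset unfolding p_def by (intro list_prod_closed) auto
  have xc: "x \<in> carrier G" using Cons.prems A.subset B.subset by auto
  have P: "list_prod G (x # xs) = x \<otimes> p" by (simp add: p_def)
  let ?goal = "x \<otimes> p \<in> A \<inter> B \<or>
     (\<exists>ys. reduced ys \<and> list_prod G ys = x \<otimes> p \<and> length ys \<le> Suc (length xs))"
  have ?goal
  proof (cases "p \<in> A \<inter> B")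
    case True
    have "x \<otimes> p \<in> A \<union> B" using Cons.prems True by auto
    moreover have "reduced [x \<otimes> p] \<and> list_prod G [x \<otimes> p] = x \<otimes> p" if "x \<otimes> p \<in> letters"
      using that pc xc by (simp add: reduced_Cons)
    ultimately show ?thesis
      by (cases "x \<otimes> p \<in> A \<inter> B") (auto intro!: exI[of _ "[x \<otimes> p]"])
  next
    case False
    then obtain ys where ys: "reduced ys" "list_prod G ys = p" "length ys \<le> length xs"
      using Cons by (auto simp: p_def)
    show ?thesis
    proof (cases ys)
      case Nil
      then show ?thesis using ys False A.one_closed B.one_closed by auto
    next
      case (Cons y zs)
      have y: "y \<in> letters" "reduced zs" "zs \<noteq> [] \<Longrightarrow> (y \<in> A) \<noteq> (hd zs \<in> A)"
        using ys(1) Cons by (auto simp: reduced_Cons)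
      have yc: "y \<in> carrier G" "list_prod G zs \<in> carrier G"
        using y letters_carrier reduced_closed by auto
      have xp: "x \<otimes> p = x \<otimes> y \<otimes> list_prod G zs" using ys(2) Cons xc yc by (simp add: m_assoc)
      consider "x \<in> A \<inter> B" | "x \<in> letters" "(x \<in> A) \<noteq> (y \<in> A)"
        | "x \<in> letters" "(x \<in> A) = (y \<in> A)" "x \<otimes> y \<notin> A \<inter> B"
        | "x \<in> letters" "(x \<in> A) = (y \<in> A)" "x \<otimes> y \<in> A \<inter> B"
        using Cons.prems by auto
      then show ?thesis
      proof cases
        case 1
        then show ?thesis using reduced_core_Cons[OF 1] ys Cons xp
          by (intro disjI2 exI[of _ "(x \<otimes> y) # zs"]) auto
      next
        case 2
        then show ?thesis using ys Cons
          by (intro disjI2 exI[of _ "x # ys"]) (auto simp: reduced_Cons)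
      next
        case 3
        have "x \<otimes> y \<in> letters \<and> (x \<otimes> y \<in> A) = (y \<in> A)" using 3 y(1) by auto
        then show ?thesis using ys Cons xp y
          by (intro disjI2 exI[of _ "(x \<otimes> y) # zs"]) (auto simp: reduced_Cons)
      next
        case 4
        show ?thesis
        proof (cases zs)
          case Nil
          then show ?thesis using 4 xp xc yc by simp
        next
          case (Cons z us)
          have "reduced ((x \<otimes> y \<otimes> z) # us)"
            using reduced_core_Cons[OF 4(3)] y(2) Cons by simp
          moreover have "z \<in> carrier G" "list_prod G us \<in> carrier G"
            using y(2) Cons letters_carrier reduced_closed by (auto simp: reduced_Cons)
          ultimately show ?thesis using Cons \<open>ys = y # zs\<close> ys xp xc yc
            by (intro disjI2 exI[of _ "(x \<otimes> y \<otimes> z) # us"]) (auto simp: m_assoc)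
        qed
      qed
    qed
  qed
  then show ?case unfolding P by simp
qed

lemma len_word_le: "set xs \<subseteq> A \<union> B \<Longrightarrow> len G A B (list_prod G xs) \<le> length xs"
  using word_reduction[of xs] len_core len_reduced by force

lemma reduced_exists:
  assumes "g \<in> carrier G" "g \<notin> A \<inter> B"
  obtains xs where "reduced xs" "list_prod G xs = g" "xs \<noteq> []"
proof -
  obtain w where w: "w \<in> lists (A <+> B)" "word_val G w = g"
    using amalgamated_product_words(1)[OF amalgamated assms(1)] by blast
  have "set (map (case_sum id id) w) \<subseteq> A \<union> B" using w(1) by auto
  then obtain xs where "reduced xs" "list_prod G xs = g"
    using word_reduction[of "map (case_sum id id) w"] w(2) assms(2)
    by (auto simp: word_val_def)
  then show ?thesis using that assms(2) by force
qed

lemma len_0_iff: "g \<in> carrier G \<Longrightarrow> len G A B g = 0 \<longleftrightarrow> g \<in> A \<inter> B"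
  using len_core reduced_exists len_reduced by (metis length_0_conv)

lemma short_word_exists:
  assumes "g \<in> carrier G"
  obtains xs where "set xs \<subseteq> A \<union> B" "list_prod G xs = g" "length xs \<le> Suc (len G A B g)"
proof (cases "g \<in> A \<inter> B")
  case True
  then show ?thesis using that[of "[g]"] assms by simp
next
  case False
  then obtain xs where "reduced xs" "list_prod G xs = g" using reduced_exists assms by blast
  then show ?thesis using that[of xs] len_reduced reduced_letters[of xs] by force
qed

text \<open>
  The summand \<open>2\<close> is there because an element of the core has length \<open>0\<close> but is written with one
  letter. It is harmless where only boundedness matters.
\<close>

lemma len_mult_le:
  assumes "g \<in> carrier G" "h \<in> carrier G"
  shows "len G A B (g \<otimes> h) \<le> len G A B g + len G A B h + 2"
proof -
  obtain xs where xs: "set xs \<subseteq> A \<union> B" "list_prod G xs = g" "length xs \<le> Suc (len G A B g)"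
    using short_word_exists assms(1) .
  obtain ys where ys: "set ys \<subseteq> A \<union> B" "list_prod G ys = h" "length ys \<le> Suc (len G A B h)"
    using short_word_exists assms(2) .
  have "list_prod G (xs @ ys) = g \<otimes> h"
    using xs ys A.subset B.subset by (subst list_prod_append) auto
  then show ?thesis using len_word_le[of "xs @ ys"] xs ys by simp
qed

section \<open>Bounded elements\<close>

abbreviation conj_by :: "'a \<Rightarrow> 'a \<Rightarrow> 'a" where
  "conj_by x h \<equiv> inv x \<otimes> h \<otimes> x"

lemma conj_by_mult:
  assumes "x \<in> carrier G" "g \<in> carrier G" "h \<in> carrier G"
  shows "conj_by x g \<otimes> conj_by x h = conj_by x (g \<otimes> h)"
proof -
  have "conj_by x g \<otimes> conj_by x h = inv x \<otimes> g \<otimes> (x \<otimes> inv x) \<otimes> h \<otimes> x"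
    using assms by (simp only: m_assoc m_closed inv_closed)
  then show ?thesis using assms by (simp add: m_assoc)
qed

lemma conj_by_inv:
  assumes "x \<in> carrier G" "g \<in> carrier G"
  shows "inv (conj_by x g) = conj_by x (inv g)"
  using assms by (simp add: inv_mult_group m_assoc)

lemma conj_by_inverse:
  assumes "x \<in> carrier G" "g \<in> carrier G"
  shows "x \<otimes> conj_by x g \<otimes> inv x = g"
proof -
  have "x \<otimes> conj_by x g \<otimes> inv x = (x \<otimes> inv x) \<otimes> g \<otimes> (x \<otimes> inv x)"
    using assms by (simp only: m_assoc m_closed inv_closed)
  then show ?thesis using assms by simp
qed

lemma conj_by_conj_by:
  assumes "x \<in> carrier G" "y \<in> carrier G" "g \<in> carrier G"
  shows "conj_by y (conj_by x g) = conj_by (x \<otimes> y) g"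
  using assms by (simp add: inv_mult_group m_assoc)

lemma len_conj_by_le:
  assumes "x \<in> carrier G"
  shows "\<exists>N. \<forall>g\<in>carrier G. len G A B (conj_by x g) \<le> len G A B g + N"
proof (intro exI ballI)
  fix g assume g: "g \<in> carrier G"
  show "len G A B (conj_by x g) \<le> len G A B g + (len G A B (inv x) + len G A B x + 4)"
    using len_mult_le[of "inv x \<otimes> g" x] len_mult_le[of "inv x" g] assms g by simp
qed

lemma conj_by_generate:
  assumes "x \<in> carrier G" "g \<in> carrier G" "h \<in> generate G {conj_by x g}"
  shows "\<exists>k\<in>generate G {g}. h = conj_by x k"
  using assms(3)
proof (induction rule: generate.induct)
  case one
  then show ?case using assms generate.one[of G "{g}"] by (intro bexI[of _ \<one>]) auto
next
  case (incl h)
  then show ?case using generate.incl[of g "{g}" G] by auto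
next
  case (inv h)
  then show ?case using generate.inv[of g "{g}" G] conj_by_inv assms by auto
next
  case (eng h1 h2)
  then obtain k1 k2 where k: "k1 \<in> generate G {g}" "k2 \<in> generate G {g}"
    "h1 = conj_by x k1" "h2 = conj_by x k2" by blast
  moreover have "k1 \<in> carrier G" "k2 \<in> carrier G"
    using k generate_in_carrier[of "{g}"] assms by auto
  ultimately show ?case using conj_by_mult assms generate.eng[of k1 G "{g}" k2] by metis
qed

lemma bounded_conj_by:
  assumes "x \<in> carrier G" "g \<in> carrier G" "bounded_element G A B g"
  shows "bounded_element G A B (conj_by x g)"
proof -
  obtain N where N: "\<forall>k\<in>generate G {g}. len G A B k \<le> N"
    using assms(3) by (auto simp: bounded_element_def bounded_subgroup_def)
  obtain M where M: "\<forall>k\<in>carrier G. len G A B (conj_by x k) \<le> len G A B k + M"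
    using len_conj_by_le assms(1) by blast
  have "len G A B h \<le> N + M" if h: "h \<in> generate G {conj_by x g}" for h
  proof -
    obtain k where k: "k \<in> generate G {g}" "h = conj_by x k"
      using conj_by_generate[OF assms(1,2) h] by blast
    have "k \<in> carrier G" using k generate_in_carrier[of "{g}"] assms by auto
    then have "len G A B h \<le> len G A B k + M" using k(2) M by simp
    then show ?thesis using k(1) N by fastforce
  qed
  then show ?thesis by (auto simp: bounded_element_def bounded_subgroup_def)
qed

lemma pow_in_generate: "g \<in> carrier G \<Longrightarrow> g [^] (k::nat) \<in> generate G {g}"
  by (induction k) (auto intro: generate.intros)

lemma list_prod_concat_replicate:
  assumes "set xs \<subseteq> carrier G"
  shows "list_prod G (concat (replicate k xs)) = list_prod G xs [^] k"
proof (induction k)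
  case (Suc k)
  have "set (concat (replicate k xs)) \<subseteq> carrier G" using assms by auto
  then show ?case
    using Suc assms nat_pow_Suc2[OF list_prod_closed[OF assms], of k]
    by (simp add: list_prod_append del: nat_pow_Suc)
qed simp

lemma reduced_concat_replicate:
  assumes "reduced xs" "xs \<noteq> []" "(last xs \<in> A) \<noteq> (hd xs \<in> A)"
  shows "reduced (concat (replicate k xs))"
proof (induction k)
  case (Suc k)
  have "hd (concat (replicate k xs)) = hd xs" if "concat (replicate k xs) \<noteq> []"
    using that assms(2) by (cases k) auto
  then show ?case using Suc assms by (auto simp: reduced_append)
qed simp

text \<open>
  If the length is even, the two ends are in different factors, so that powers of the word are
  reduced and their lengths grow without bound.
\<close>

lemma bounded_reduced_odd:
  assumes "reduced xs" "xs \<noteq> []" "bounded_element G A B (list_prod G xs)"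
  shows "odd (length xs)"
proof (rule ccontr)
  assume "\<not> odd (length xs)"
  then have red: "reduced (concat (replicate k xs))" for k
    using reduced_concat_replicate[OF assms(1,2)] hd_last_reduced[OF assms(1,2)] by blast
  obtain N where N: "\<forall>k\<in>generate G {list_prod G xs}. len G A B k \<le> N"
    using assms(3) by (auto simp: bounded_element_def bounded_subgroup_def)
  have "length (concat (replicate (Suc N) xs)) \<le> N"
    using N pow_in_generate[OF reduced_closed[OF assms(1)], of "Suc N"] len_reduced[OF red, of "Suc N"]
      list_prod_concat_replicate[OF reduced_carrier[OF assms(1)], of "Suc N"] by metis
  moreover have "length (concat (replicate (Suc N) xs)) \<ge> Suc N * 1"
    using assms(2) unfolding length_concat map_replicate sum_list_replicate
    by (intro mult_le_mono) (auto simp: Suc_le_eq)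
  ultimately show False by simp
qed

text \<open>
  Induction on half of the length. Conjugation by the first letter \<open>k\<close> moves it behind the last letter
  \<open>l\<close>, which is in the same factor because the length is odd. If \<open>l \<otimes> k\<close> were not in the core,
  this would give a reduced word of even length for a bounded element. So it is in the core, and the
  letter in front of it absorbs it, which leaves the first half of the remaining word unchanged.
  The result is not in the core, as it is the middle letter up to a factor from the core.
\<close>

lemma bounded_conj_by_half:
  assumes "F = A \<or> F = B"
  shows "reduced xs \<Longrightarrow> length xs = 2 * s + 1 \<Longrightarrow> bounded_element G A B (list_prod G xs) \<Longrightarrow>
    xs ! s \<in> F \<Longrightarrow> conj_by (list_prod G (take s xs)) (list_prod G xs) \<in> F - A \<inter> B"
proof (induction s arbitrary: xs)
  case 0
  obtain x where x: "xs = [x]" using "0.prems"(2) by (cases xs) auto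
  have l: "x \<in> letters" "x \<in> F" using "0.prems"(1,4) unfolding x reduced_Cons by simp_all
  then have "x \<in> carrier G" using letters_carrier by blast
  then show ?case using x l by simp
next
  case (Suc s)
  obtain k us where ku: "xs = k # us" "length us = 2 * s + 2"
    using Suc.prems(2) by (cases xs) auto
  then obtain ys l where yl: "us = ys @ [l]" "length ys = 2 * s + 1"
    by (cases us rule: rev_cases) auto
  have xs: "xs = k # ys @ [l]" using ku yl by simp
  have ys: "reduced ys" "ys \<noteq> []" "k \<in> letters" "l \<in> letters"
    "(k \<in> A) \<noteq> (hd ys \<in> A)" "(last ys \<in> A) \<noteq> (l \<in> A)"
    using Suc.prems(1) yl(2) unfolding xs by (cases "ys = []", auto simp: reduced_Cons reduced_append)+
  have c: "k \<in> carrier G" "l \<in> carrier G" "list_prod G ys \<in> carrier G" "set ys \<subseteq> carrier G"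
    using ys letters_carrier reduced_closed reduced_carrier by auto
  have kl: "(k \<in> A) = (l \<in> A)"
    using hd_last_reduced[OF Suc.prems(1)] Suc.prems(2) xs by auto
  have P: "list_prod G xs = k \<otimes> (list_prod G ys \<otimes> l)"
    using c by (simp add: xs list_prod_append)
  have conj: "conj_by k (list_prod G xs) = list_prod G ys \<otimes> (l \<otimes> k)"
    unfolding P using c by (simp add: m_assoc[symmetric])
  have bdd: "bounded_element G A B (list_prod G ys \<otimes> (l \<otimes> k))"
    using bounded_conj_by[OF c(1) _ Suc.prems(3)] reduced_closed[OF Suc.prems(1)] conj by simp
  have core: "l \<otimes> k \<in> A \<inter> B"
  proof (rule ccontr)
    assume n: "l \<otimes> k \<notin> A \<inter> B"
    have "l \<otimes> k \<in> letters \<and> (l \<otimes> k \<in> A) = (l \<in> A)" using n ys kl by auto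
    then have r: "reduced (ys @ [l \<otimes> k])" using ys by (auto simp: reduced_append reduced_Cons)
    have "list_prod G (ys @ [l \<otimes> k]) = list_prod G ys \<otimes> (l \<otimes> k)"
      using c by (simp add: list_prod_append)
    then show False using bounded_reduced_odd[OF r] bdd yl(2) by simp
  qed
  obtain vs y where vs: "ys = vs @ [y]" using ys(2) by (cases ys rule: rev_cases) auto
  define zs where "zs = vs @ [y \<otimes> (l \<otimes> k)]"
  have vc: "set vs \<subseteq> carrier G" "y \<in> carrier G" using c(4) vs by auto
  have z1: "reduced zs" using reduced_snoc_core[OF core] ys(1) vs by (simp add: zs_def)
  have z2: "length zs = 2 * s + 1" using yl(2) vs by (simp add: zs_def)
  have zc: "list_prod G zs = conj_by k (list_prod G xs)"
    unfolding conj using c vc by (simp add: zs_def vs list_prod_append m_assoc list_prod_closed)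
  have len: "length vs = 2 * s" using yl(2) vs by simp
  \<comment> \<open>For \<open>s = 0\<close> the middle letter is itself the last letter, which has absorbed \<open>l \<otimes> k\<close>.\<close>
  have "ys ! s \<in> F" using Suc.prems(4) yl(2) by (simp add: xs nth_append)
  then have z4: "zs ! s \<in> F"
    using core_mult_iff[OF assms core vc(2)] len by (cases s) (auto simp: zs_def vs nth_append)
  have "take s zs = take s ys" using len by (simp add: zs_def vs)
  then have T: "list_prod G (take (Suc s) xs) = k \<otimes> list_prod G (take s zs)"
    using yl(2) by (simp add: xs)
  have "list_prod G (take s zs) \<in> carrier G"
    using reduced_carrier[OF z1] set_take_subset[of s zs] by (intro list_prod_closed) blast
  then have "conj_by (list_prod G (take (Suc s) xs)) (list_prod G xs) =
      conj_by (list_prod G (take s zs)) (list_prod G zs)"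
    unfolding T zc using conj_by_conj_by c(1) reduced_closed[OF Suc.prems(1)] by metis
  then show ?case using Suc.IH[OF z1 z2 _ z4] bdd zc conj by simp
qed

section \<open>A common factor\<close>

lemma list_prod_inv_rev:
  "set us \<subseteq> carrier G \<Longrightarrow> list_prod G (map (m_inv G) (rev us)) = inv (list_prod G us)"
proof (induction us)
  case (Cons u us)
  have "set (map (m_inv G) (rev us)) \<subseteq> carrier G" using Cons.prems by auto
  then show ?case
    using Cons list_prod_closed[of us] by (simp add: list_prod_append inv_mult_group)
qed simp

lemma inv_in_factor: "x \<in> carrier G \<Longrightarrow> inv x \<in> A \<longleftrightarrow> x \<in> A" "x \<in> carrier G \<Longrightarrow> inv x \<in> B \<longleftrightarrow> x \<in> B"
  using A.m_inv_closed B.m_inv_closed inv_inv by metis+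

lemma reduced_inv_rev:
  "reduced us \<Longrightarrow> reduced (map (m_inv G) (rev us))"
proof (induction us)
  case (Cons u us)
  have u: "u \<in> letters" "reduced us" "us \<noteq> [] \<Longrightarrow> (u \<in> A) \<noteq> (hd us \<in> A)"
    using Cons.prems by (auto simp: reduced_Cons)
  have uc: "u \<in> carrier G" using u letters_carrier by blast
  have "hd us \<in> carrier G" if "us \<noteq> []" using reduced_carrier[OF u(2)] that by auto
  then show ?case using Cons.IH[OF u(2)] u uc inv_in_factor
    by (auto simp: reduced_append reduced_Cons last_map last_rev)
qed simp

text \<open>
  The heart of the proof. The word \<open>us\<close> is the first half of the longest generator, which it
  conjugates to \<open>a\<close>. If the conjugate of \<open>h\<close> were not in \<open>F\<close>, a reduced word \<open>xs\<close> for it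
  would have odd length, so both of its ends would be in the same factor. If they are in \<open>F\<close>, then
  \<open>xs\<close> can be put between \<open>us\<close> and the inverse of \<open>us\<close> without cancellation, and the bound on the
  length of \<open>h\<close> leaves only one letter for \<open>xs\<close>, which is then in \<open>F\<close>. If they are not in \<open>F\<close>,
  then \<open>a # xs\<close> is a reduced word of even length for a bounded element.
\<close>

lemma bounded_conj_by_in_factor:
  assumes F: "F = A \<or> F = B" and us: "reduced us" "us \<noteq> [] \<Longrightarrow> last us \<notin> F"
    and a: "a \<in> F - A \<inter> B" and h: "h \<in> carrier G" "len G A B h \<le> 2 * length us + 1"
    and bdd: "bounded_element G A B (conj_by (list_prod G us) h)"
      "bounded_element G A B (a \<otimes> conj_by (list_prod G us) h)"
  shows "conj_by (list_prod G us) h \<in> F"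
proof (rule ccontr)
  define u where "u = list_prod G us"
  have uc: "u \<in> carrier G" using reduced_closed[OF us(1)] by (simp add: u_def)
  assume "conj_by (list_prod G us) h \<notin> F"
  then have notF: "conj_by u h \<notin> F" by (simp add: u_def)
  have hc: "conj_by u h \<in> carrier G" using uc h by simp
  have al: "a \<in> letters" using a F by auto
  obtain xs where xs: "reduced xs" "list_prod G xs = conj_by u h" "xs \<noteq> []"
    using reduced_exists[OF hc] notF F by auto
  have odd: "odd (length xs)"
    using bounded_reduced_odd[OF xs(1,3)] xs(2) bdd(1) by (simp add: u_def)
  have lx: "hd xs \<in> letters" "last xs \<in> letters"
    using reduced_letters[OF xs(1)] hd_in_set[OF xs(3)] last_in_set[OF xs(3)] by blast+
  show False
  proof (cases "hd xs \<in> F")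
    case True
    define vs where "vs = map (m_inv G) (rev us)"
    have lF: "last xs \<in> F"
      using hd_last_reduced[OF xs(1,3)] odd letter_in_factor[OF F lx] True by blast
    have v: "reduced vs" "list_prod G vs = inv u" "length vs = length us"
      using reduced_inv_rev[OF us(1)] list_prod_inv_rev[OF reduced_carrier[OF us(1)]]
      by (auto simp: vs_def u_def)
    have lu: "(last us \<in> A) \<noteq> (x \<in> A)" if "us \<noteq> []" "x \<in> F" "x \<in> letters" for x
      using letter_in_factor[OF F _ that(3), of "last us"] subsetD[OF reduced_letters[OF us(1)] last_in_set]
        us(2) that by blast
    have hv: "(hd vs \<in> A) = (last us \<in> A)" if "us \<noteq> []"
    proof -
      have "last us \<in> carrier G" using reduced_carrier[OF us(1)] last_in_set[OF that] by blast
      then show ?thesis using that inv_in_factor(1) by (simp add: vs_def hd_map hd_rev)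
    qed
    have "reduced (us @ xs @ vs)"
    proof (cases "us = []")
      case True
      then show ?thesis using xs(1) v(3) by simp
    next
      case False
      then have "(last us \<in> A) \<noteq> (hd xs \<in> A)" "(last xs \<in> A) \<noteq> (hd vs \<in> A)"
        using lu[OF False True lx(1)] lu[OF False lF lx(2)] hv by blast+
      then show ?thesis using us(1) xs(1,3) v(1) unfolding reduced_append by simp
    qed
    moreover have "list_prod G (us @ xs @ vs) = u \<otimes> conj_by u h \<otimes> inv u"
      using reduced_carrier[OF us(1)] reduced_carrier[OF xs(1)] reduced_carrier[OF v(1)] uc hc
        v(2) xs(2) h(1)
      by (simp add: list_prod_append u_def[symmetric] m_assoc)
    ultimately have "len G A B h = 2 * length us + length xs"
      using len_reduced[of "us @ xs @ vs"] conj_by_inverse[OF uc h(1)] v(3) by simp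
    then have "length xs \<le> 1" using h(2) by simp
    then obtain x where x: "xs = [x]" using xs(3) by (cases xs) auto
    then have "x \<in> carrier G" using reduced_carrier[OF xs(1)] by simp
    then show False using True xs(2) notF x by simp
  next
    case False
    then have "reduced (a # xs)"
      using al xs letter_in_factor[OF F al lx(1)] a by (auto simp: reduced_Cons)
    then show False using bounded_reduced_odd[of "a # xs"] odd bdd(2) xs(2) by (simp add: u_def)
  qed
qed

lemma conj_set_eq: "conj_set G x K = conj_by x ` K"
  by (auto simp: conj_set_def l_coset_def r_coset_def)

lemma conj_by_generate_subset:
  assumes x: "x \<in> carrier G" and F: "subgroup F G" and S: "S \<subseteq> carrier G" "conj_by x ` S \<subseteq> F"
  shows "conj_by x ` generate G S \<subseteq> F"
proof clarify
  interpret F: subgroup F G by fact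
  fix h assume "h \<in> generate G S"
  then show "conj_by x h \<in> F"
  proof (induction rule: generate.induct)
    case (inv h)
    then have "h \<in> carrier G" "conj_by x h \<in> F" using S by auto
    then show ?case using conj_by_inv[OF x, of h] F.m_inv_closed by metis
  next
    case (eng h1 h2)
    then show ?case
      using conj_by_mult[OF x, of h1 h2] generate_in_carrier[OF S(1)] F.m_closed by metis
  qed (use x S in auto)
qed

lemma subgroup_conj_set:
  assumes x: "x \<in> carrier G" and K: "subgroup K G"
  shows "subgroup (conj_set G x K) G"
proof
  interpret K: subgroup K G by fact
  show "conj_set G x K \<subseteq> carrier G" using x by (auto simp: conj_set_eq)
  show "\<one> \<in> conj_set G x K" using x by (auto simp: conj_set_eq intro!: image_eqI[of _ _ \<one>])
  show "g \<otimes> h \<in> conj_set G x K" if "g \<in> conj_set G x K" "h \<in> conj_set G x K" for g h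
    using that conj_by_mult[OF x] by (auto simp: conj_set_eq)
  show "inv g \<in> conj_set G x K" if "g \<in> conj_set G x K" for g
    using that conj_by_inv[OF x] by (auto simp: conj_set_eq)
qed

lemma conj_to_subgroup_of_subset:
  assumes K: "subgroup K G" and F: "K \<subseteq> F"
  shows "conj_to_subgroup_of G K F"
proof -
  have "conj_by \<one> k = k" if "k \<in> K" for k using subgroup.mem_carrier[OF K that] by simp
  then have "conj_set G \<one> K = K" by (simp add: conj_set_eq)
  then show ?thesis using K F unfolding conj_to_subgroup_of_def by (intro bexI[of _ \<one>]) auto
qed

text \<open>
  Elements of a factor have length at most one, and boundedness is invariant under conjugation.
\<close>

lemma bounded_if_conj_to_factor:
  assumes F: "F = A \<or> F = B" and K: "subgroup K G" "conj_to_subgroup_of G K F" and g: "g \<in> K"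
  shows "bounded_element G A B g"
proof -
  interpret K: subgroup K G by fact
  interpret F: subgroup F G using factor_subgroup[OF F] .
  obtain x where x: "x \<in> carrier G" "conj_by x ` K \<subseteq> F"
    using K(2) by (auto simp: conj_to_subgroup_of_def conj_set_eq)
  have gF: "conj_by x g \<in> F" using x g by auto
  have "generate G {conj_by x g} \<subseteq> F"
    using gF F.subgroup_axioms by (intro generate_subgroup_incl) auto
  moreover have "len G A B f \<le> 1" if "f \<in> F" for f
    using len_word_le[of "[f]"] that F by auto
  ultimately have "bounded_element G A B (conj_by x g)"
    by (auto simp: bounded_element_def bounded_subgroup_def)
  then have "bounded_element G A B (conj_by (inv x) (conj_by x g))"
    using x g by (intro bounded_conj_by[of "inv x" "conj_by x g"]) auto
  then show ?thesis using conj_by_inverse[OF x(1), of g] g x(1) by simp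
qed

text \<open>
  The factor is the one that contains the middle letter \<open>ks ! s\<close>. For a generator \<open>h\<close> other than \<open>g\<close>,
  conjugation turns the product \<open>g \<otimes> h\<close> into that of an element of \<open>F\<close> outside the core and the
  conjugate of \<open>h\<close>, which is what \<open>bounded_conj_by_in_factor\<close> asks for.
\<close>

lemma conj_to_factor_of_bounded:
  assumes S: "S \<subseteq> carrier G" and g: "g \<in> S" and max: "\<And>h. h \<in> S \<Longrightarrow> len G A B h \<le> len G A B g"
    and bdd: "\<And>h. h \<in> S \<Longrightarrow> bounded_element G A B h"
      "\<And>h. h \<in> S \<Longrightarrow> h \<noteq> g \<Longrightarrow> bounded_element G A B (g \<otimes> h)"
    and ks: "reduced ks" "list_prod G ks = g" "length ks = 2 * s + 1"
  shows "conj_set G (list_prod G (take s ks)) (generate G S) \<subseteq> A \<or>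
    conj_set G (list_prod G (take s ks)) (generate G S) \<subseteq> B"
proof -
  define us where "us = take s ks"
  define u where "u = list_prod G us"
  have split: "ks = us @ ks ! s # drop (Suc s) ks" using ks(3) by (simp add: us_def id_take_nth_drop)
  have r: "reduced (us @ ks ! s # drop (Suc s) ks)" using ks(1) by (simp only: split[symmetric])
  have us: "reduced us" "ks ! s \<in> letters" "us \<noteq> [] \<Longrightarrow> (last us \<in> A) \<noteq> (ks ! s \<in> A)" "length us = s"
    using r ks(3) by (simp_all add: reduced_append reduced_Cons us_def)
  have uc: "u \<in> carrier G" using reduced_closed[OF us(1)] by (simp add: u_def)
  obtain F where F: "F = A \<or> F = B" "ks ! s \<in> F" using us(2) by blast
  have luF: "last us \<notin> F" if "us \<noteq> []"
    using letter_in_factor[OF F(1) us(2), of "last us"] reduced_letters[OF us(1)] us(3) that F(2)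
    by (metis last_in_set subsetD)
  have gc: "g \<in> carrier G" using S g by auto
  have a: "conj_by u g \<in> F - A \<inter> B"
    using bounded_conj_by_half[OF F(1) ks(1,3) _ F(2)] bdd(1)[OF g] ks(2) by (simp add: u_def us_def)
  have "conj_by u h \<in> F" if h: "h \<in> S" for h
  proof (cases "h = g")
    case False
    have hc: "h \<in> carrier G" using h S by auto
    have "bounded_element G A B (conj_by u g \<otimes> conj_by u h)"
      using bounded_conj_by[OF uc _ bdd(2)[OF h False]] conj_by_mult[OF uc gc hc] gc hc by simp
    moreover have "len G A B h \<le> 2 * length us + 1"
      using max[OF h] len_reduced[OF ks(1)] ks us(4) by simp
    ultimately show ?thesis
      using bounded_conj_by_in_factor[OF F(1) us(1) luF a hc] bounded_conj_by[OF uc hc bdd(1)[OF h]]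
      by (simp add: u_def)
  qed (use a in simp)
  then have "conj_by u ` generate G S \<subseteq> F"
    using uc factor_subgroup[OF F(1)] S by (intro conj_by_generate_subset) auto
  then show ?thesis using F(1) by (auto simp: conj_set_eq u_def us_def)
qed

end

theorem theorem2:
  fixes G :: "('a, 'm) monoid_scheme" and A B H :: "'a set"
    and g :: "nat \<Rightarrow> 'a" and n :: nat
  assumes "amalgamated_product G A B"
    and "n \<ge> 1"
    and "\<And>j. j \<in> {1..n} \<Longrightarrow> g j \<in> carrier G"
    and "H = generate G (g ` {1..n})"
    and "len G A B (g 1) = Max ((\<lambda>j. len G A B (g j)) ` {1..n})"
  shows "(conj_to_subgroup_of G H A \<or> conj_to_subgroup_of G H B \<longleftrightarrow>
            (\<forall>j\<in>{1..n}. bounded_element G A B (g j)) \<and>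
            (\<forall>j\<in>{1..n} - {1}. bounded_element G A B (g 1 \<otimes>\<^bsub>G\<^esub> g j)))
       \<and> ((conj_to_subgroup_of G H A \<or> conj_to_subgroup_of G H B) \<and> len G A B (g 1) > 1 \<longrightarrow>
            odd (len G A B (g 1)) \<and>
            (\<forall>ks s. reduced_expr G A B ks (g 1) \<and> length ks = 2 * s + 1 \<longrightarrow>
               s \<ge> 1 \<and>
               (conj_set G (list_prod G (take s ks)) H \<subseteq> A \<or>
                conj_set G (list_prod G (take s ks)) H \<subseteq> B)))"
    (is "(?conj \<longleftrightarrow> ?bdd) \<and> ?ii")
proof -
  interpret amalgamated_group G A B
    using assms(1) by (simp add: amalgamated_group_def amalgamated_group_axioms_def amalgamated_product_def)
  define S where "S = g ` {1..n}"
  have S: "S \<subseteq> carrier G" using assms(3) by (auto simp: S_def)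
  have g1: "g 1 \<in> S" "g 1 \<in> carrier G" using assms(2,3) by (auto simp: S_def)
  have H: "H = generate G S" using assms(4) by (simp add: S_def)
  have Hsub: "subgroup H G" using generate_is_subgroup[OF S] H by simp
  have gH: "g j \<in> H" if "j \<in> {1..n}" for j using that H by (auto simp: S_def intro: generate.incl)
  have max: "len G A B h \<le> len G A B (g 1)" if "h \<in> S" for h
    using that unfolding assms(5) by (auto simp: S_def)
  have bounded: ?bdd if ?conj
  proof -
    have b: "bounded_element G A B h" if "h \<in> H" for h
      using bounded_if_conj_to_factor[OF _ Hsub _ that] \<open>?conj\<close> by blast
    have "g 1 \<in> H" using gH assms(2) by auto
    then show ?bdd using b gH subgroup.m_closed[OF Hsub] by auto
  qed
  have half: "conj_set G (list_prod G (take s ks)) H \<subseteq> A \<or> conj_set G (list_prod G (take s ks)) H \<subseteq> B"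
    if ?bdd "reduced ks" "list_prod G ks = g 1" "length ks = 2 * s + 1" for ks s
    unfolding H using that S g1(1) max
    by (intro conj_to_factor_of_bounded[where g = "g 1"]) (auto simp: S_def)
  have odd_len: "odd (length ks)" if ?bdd "reduced ks" "list_prod G ks = g 1" "ks \<noteq> []" for ks
    using bounded_reduced_odd[OF that(2,4)] that(1,3) assms(2) by auto
  have conj: ?conj if b: ?bdd
  proof (cases "g 1 \<in> A \<inter> B")
    case True
    \<comment> \<open>By maximality all generators have length \<open>0\<close>, so no conjugation is necessary.\<close>
    have "S \<subseteq> A" using max len_core[OF True] len_0_iff S by auto
    then have "H \<subseteq> A" using generate_subgroup_incl[OF _ A.subgroup_axioms] H by simp
    then show ?thesis using conj_to_subgroup_of_subset[OF Hsub] by blast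
  next
    case False
    then obtain ks where ks: "reduced ks" "list_prod G ks = g 1" "ks \<noteq> []"
      using reduced_exists g1 by blast
    then obtain s where s: "length ks = 2 * s + 1" using odd_len[OF b] by (metis oddE)
    have "list_prod G (take s ks) \<in> carrier G"
      using reduced_carrier[OF ks(1)] set_take_subset[of s ks] by (intro list_prod_closed) blast
    then show ?thesis
      using half[OF b ks(1,2) s] subgroup_conj_set[OF _ Hsub] unfolding conj_to_subgroup_of_def by blast
  qed
  have ?ii
  proof (intro impI conjI allI)
    assume a: "?conj \<and> len G A B (g 1) > 1"
    then have bdd: ?bdd using bounded by blast
    obtain ks where "reduced ks" "list_prod G ks = g 1" "ks \<noteq> []"
      using reduced_exists g1(2) len_core a by (metis not_less_zero)
    then show "odd (len G A B (g 1))" using odd_len[OF bdd] len_reduced by metis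
    fix ks s assume k: "reduced_expr G A B ks (g 1) \<and> length ks = 2 * s + 1"
    then show "conj_set G (list_prod G (take s ks)) H \<subseteq> A \<or> conj_set G (list_prod G (take s ks)) H \<subseteq> B"
      using half[OF bdd] by (simp add: reduced_expr_iff)
    have "len G A B (g 1) = length ks" using k len_reduced unfolding reduced_expr_iff by metis
    then show "s \<ge> 1" using a k by simp
  qed
  then show ?thesis using bounded conj by blast
qed

end
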